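(* Let $P$ and $Q$ be probability distributions on a measurable space $(\mathcal{X},\mathcal{F})$. For $\alpha\in[-\infty,\infty]$, the Rényi divergence $D_\alpha(P\|Q)$ is nondecreasing in $\alpha$.
   Context: Let $P,Q$ have densities $p,q$ with respect to a dominating $\sigma$-finite measure $\mu$ (whose choice is immaterial). For finite real $\alpha\notin\{0,1\}$, $D_\alpha(P\|Q)=\frac{1}{\alpha-1}\ln\int p^\alpha q^{1-\alpha}\,d\mu\in[-\infty,\infty]$, where for $\alpha>1$ one reads $p^\alpha q^{1-\alpha}$ as $p^\alpha/q^{\alpha-1}$ and for $\alpha<0$ as $q^{1-\alpha}/p^{-\alpha}$, with the conventions $0/0=0$ and $x/0=\infty$ for $x>0$. The remaining orders are defined by $D_0(P\|Q)=\lim_{\alpha\downarrow0}D_\alpha(P\|Q)$, $D_1(P\|Q)=\lim_{\alpha\uparrow1}D_\alpha(P\|Q)$, $D_\infty(P\|Q)=\lim_{\alpha\uparrow\infty}D_\alpha(P\|Q)$ and $D_{-\infty}(P\|Q)=\lim_{\alpha\downarrow-\infty}D_\alpha(P\|Q)$ (these limits always exist). *)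

theory Defs
  imports "HOL-Probability.Probability_Measure"
begin

definition ln_ennreal :: "ennreal \<Rightarrow> ereal" where
  "ln_ennreal x = (if x = 0 then - \<infinity> else if x = \<infinity> then \<infinity> else ereal (ln (enn2real x)))"

text \<open>
  The value of \<open>x\<^sup>\<alpha> y\<^sup>1\<^sup>-\<^sup>\<alpha>\<close> for \<open>x, y \<ge> 0\<close> and \<open>\<alpha> \<noteq> 0, 1\<close>. All exponents below are positive, so
  that \<open>0 powr _ = 0\<close> is the intended value, and division on \<^typ>\<open>ennreal\<close> satisfies \<open>0 / 0 = 0\<close> and
  \<open>x / 0 = \<infinity>\<close> for \<open>x > 0\<close>.
\<close>

definition renyi_integrand :: "real \<Rightarrow> real \<Rightarrow> real \<Rightarrow> ennreal" where
  "renyi_integrand \<alpha> x y =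
    (if \<alpha> > 1 then ennreal (x powr \<alpha>) / ennreal (y powr (\<alpha> - 1))
     else if \<alpha> < 0 then ennreal (y powr (1 - \<alpha>)) / ennreal (x powr (- \<alpha>))
     else ennreal (x powr \<alpha> * y powr (1 - \<alpha>)))"

text \<open>Intended for nonnegative real densities \<open>p\<close>, \<open>q\<close> with respect to \<open>\<mu>\<close>, and for \<open>\<alpha> \<noteq> 0, 1\<close>.\<close>

definition renyi_of_densities ::
    "'a measure \<Rightarrow> ('a \<Rightarrow> real) \<Rightarrow> ('a \<Rightarrow> real) \<Rightarrow> real \<Rightarrow> ereal" where
  "renyi_of_densities \<mu> p q \<alpha> =
    ereal (1 / (\<alpha> - 1)) * ln_ennreal (\<integral>\<^sup>+x. renyi_integrand \<alpha> (p x) (q x) \<partial>\<mu>)"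

text \<open>
  As dominating measure we fix \<open>P + Q\<close>; lemma \<open>renyi_simple_eq\<close> below shows that any other
  dominating measure, with any choice of densities, gives the same value.
\<close>

definition sum_measure :: "'a measure \<Rightarrow> 'a measure \<Rightarrow> 'a measure" where
  "sum_measure P Q = measure_of (space P) (sets P) (\<lambda>A. emeasure P A + emeasure Q A)"

definition real_density :: "'a measure \<Rightarrow> 'a measure \<Rightarrow> 'a \<Rightarrow> real" where
  "real_density \<mu> P x = enn2real (RN_deriv \<mu> P x)"

definition renyi_simple :: "'a measure \<Rightarrow> 'a measure \<Rightarrow> real \<Rightarrow> ereal" where
  "renyi_simple P Q =
    renyi_of_densities (sum_measure P Q)
      (real_density (sum_measure P Q) P) (real_density (sum_measure P Q) Q)"

definition renyi_divergence :: "ereal \<Rightarrow> 'a measure \<Rightarrow> 'a measure \<Rightarrow> ereal" where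
  "renyi_divergence \<alpha> P Q =
    (if \<alpha> = - \<infinity> then Lim at_bot (renyi_simple P Q)
     else if \<alpha> = \<infinity> then Lim at_top (renyi_simple P Q)
     else if \<alpha> = 0 then Lim (at_right 0) (renyi_simple P Q)
     else if \<alpha> = 1 then Lim (at_left 1) (renyi_simple P Q)
     else renyi_simple P Q (real_of_ereal \<alpha>))"

lemma space_sum_measure [simp]: "space (sum_measure P Q) = space P"
  and sets_sum_measure [simp, measurable_cong]: "sets (sum_measure P Q) = sets P"
  by (simp_all add: sum_measure_def)

lemma emeasure_sum_measure:
  assumes "sets P = sets Q" "A \<in> sets P"
  shows "emeasure (sum_measure P Q) A = emeasure P A + emeasure Q A"
proof (rule emeasure_measure_of[OF sum_measure_def])
  show "sets P \<subseteq> Pow (space P)" by (rule sets.space_closed)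
  show "A \<in> sets (sum_measure P Q)" using assms by simp
  show "positive (sets (sum_measure P Q)) (\<lambda>A. emeasure P A + emeasure Q A)"
    by (simp add: positive_def)
  show "countably_additive (sets (sum_measure P Q)) (\<lambda>A. emeasure P A + emeasure Q A)"
  proof (rule countably_additiveI)
    fix B :: "nat \<Rightarrow> 'a set"
    assume B: "range B \<subseteq> sets (sum_measure P Q)" "disjoint_family B"
    have "(\<Sum>i. emeasure P (B i) + emeasure Q (B i)) = (\<Sum>i. emeasure P (B i)) + (\<Sum>i. emeasure Q (B i))"
      by (rule suminf_add[symmetric]) auto
    also have "\<dots> = emeasure P (\<Union>i. B i) + emeasure Q (\<Union>i. B i)"
      using B assms by (simp add: suminf_emeasure)
    finally show "(\<Sum>i. emeasure P (B i) + emeasure Q (B i)) =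
        emeasure P (\<Union> (range B)) + emeasure Q (\<Union> (range B))" .
  qed
qed

lemma density_real_density:
  assumes "finite_measure \<mu>" "finite_measure P" "absolutely_continuous \<mu> P" "sets P = sets \<mu>"
  shows "density \<mu> (\<lambda>x. ennreal (real_density \<mu> P x)) = P"
proof -
  interpret \<mu>: finite_measure \<mu> by fact
  interpret P: finite_measure P by fact
  have "AE x in \<mu>. RN_deriv \<mu> P x \<noteq> \<infinity>"
    using \<mu>.RN_deriv_finite[OF P.sigma_finite_measure_axioms assms(3,4)] by auto
  then have "AE x in \<mu>. ennreal (real_density \<mu> P x) = RN_deriv \<mu> P x"
    by eventually_elim (simp add: real_density_def less_top)
  then have "density \<mu> (\<lambda>x. ennreal (real_density \<mu> P x)) = density \<mu> (RN_deriv \<mu> P)"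
    by (intro density_cong) (auto simp: real_density_def)
  then show ?thesis using \<mu>.density_RN_deriv[OF assms(3,4)] by simp
qed

lemma renyi_integrand_homogeneous:
  assumes "c > 0" "x \<ge> 0" "y \<ge> 0"
  shows "renyi_integrand \<alpha> (c * x) (c * y) = ennreal c * renyi_integrand \<alpha> x y"
proof -
  have *: "ennreal (a * u) / ennreal (b * v) = ennreal (a / b) * (ennreal u / ennreal v)"
    if "a > 0" "b > 0" "u \<ge> 0" "v \<ge> 0" for a b u v :: real
  proof (cases "v = 0")
    case True
    then show ?thesis using that
      by (cases "u = 0") (auto simp: ennreal_divide_zero ennreal_mult_top divide_ennreal_def
        ennreal_zero_divide zero_less_mult_iff ennreal_mult_eq_top_iff)
  next
    case False
    then show ?thesis using that
      by (simp add: divide_ennreal ennreal_mult[symmetric])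
  qed
  have pw: "c powr a / c powr b = c" if "a - b = 1" for a b
    using that assms by (simp add: powr_diff[symmetric])
  have pw': "c powr a * c powr b = c" if "a + b = 1" for a b
    using that assms by (simp add: powr_add[symmetric])
  show ?thesis
    using assms pw'[of \<alpha> "1 - \<alpha>"]
    by (auto simp: renyi_integrand_def powr_mult * pw ennreal_mult[symmetric] mult_ac
        intro!: arg_cong[of _ _ ennreal])
qed

lemma renyi_integrand_measurable [measurable]:
  assumes [measurable]: "p \<in> borel_measurable M" "q \<in> borel_measurable M"
  shows "(\<lambda>x. renyi_integrand \<alpha> (p x) (q x)) \<in> borel_measurable M"
  unfolding renyi_integrand_def by measurable

lemma renyi_simple_eq:
  fixes p q :: "'a \<Rightarrow> real"
  assumes P: "finite_measure P" and Q: "finite_measure Q" and PQ: "sets P = sets Q"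
    and [measurable]: "p \<in> borel_measurable \<mu>" "q \<in> borel_measurable \<mu>"
    and nonneg: "\<And>x. p x \<ge> 0" "\<And>x. q x \<ge> 0"
    and Pp: "P = density \<mu> (\<lambda>x. ennreal (p x))" and Qq: "Q = density \<mu> (\<lambda>x. ennreal (q x))"
  shows "renyi_simple P Q = renyi_of_densities \<mu> p q"
proof -
  let ?M = "sum_measure P Q"
  define p' where "p' = real_density ?M P"
  define q' where "q' = real_density ?M Q"
  interpret P: finite_measure P by fact
  interpret Q: finite_measure Q by fact
  have [measurable_cong, simp]: "sets P = sets \<mu>" "sets Q = sets \<mu>" and sp: "space P = space \<mu>"
    by (simp_all add: Pp Qq)
  have p'q' [measurable]: "p' \<in> borel_measurable \<mu>" "q' \<in> borel_measurable \<mu>"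
    using borel_measurable_RN_deriv[of ?M P] borel_measurable_RN_deriv[of ?M Q]
    by (simp_all add: p'_def q'_def real_density_def [abs_def] cong: measurable_cong_sets)
  have nn': "p' x \<ge> 0" "q' x \<ge> 0" for x
    by (simp_all add: p'_def q'_def real_density_def)
  have em: "emeasure ?M A = emeasure P A + emeasure Q A" if "A \<in> sets \<mu>" for A
    using emeasure_sum_measure[OF PQ] that by simp
  have M: "?M = density \<mu> (\<lambda>x. ennreal (p x + q x))"
  proof (rule measure_eqI)
    fix A assume "A \<in> sets ?M"
    then have A [measurable]: "A \<in> sets \<mu>" by simp
    have "emeasure ?M A = (\<integral>\<^sup>+x. ennreal (p x) * indicator A x \<partial>\<mu>) + (\<integral>\<^sup>+x. ennreal (q x) * indicator A x \<partial>\<mu>)"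
      using em[OF A] by (simp add: Pp Qq emeasure_density)
    also have "\<dots> = (\<integral>\<^sup>+x. ennreal (p x + q x) * indicator A x \<partial>\<mu>)"
      by (subst nn_integral_add[symmetric]) (auto simp: nonneg ennreal_plus distrib_right)
    finally show "emeasure ?M A = emeasure (density \<mu> (\<lambda>x. ennreal (p x + q x))) A"
      by (simp add: emeasure_density)
  qed simp
  have fM: "finite_measure ?M"
  proof
    have "space P \<in> sets \<mu>" by (simp add: sp)
    then have "emeasure ?M (space P) = emeasure P (space P) + emeasure Q (space P)" by (rule em)
    then show "emeasure ?M (space ?M) \<noteq> \<infinity>" by simp
  qed
  have ac: "absolutely_continuous ?M P" "absolutely_continuous ?M Q"
    by (auto simp: absolutely_continuous_def null_sets_def em)
  have dP: "density ?M (\<lambda>x. ennreal (p' x)) = P" and dQ: "density ?M (\<lambda>x. ennreal (q' x)) = Q"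
    unfolding p'_def q'_def using density_real_density[OF fM P ac(1)] density_real_density[OF fM Q ac(2)]
    by simp_all
  have eq: "AE x in \<mu>. ennreal (r x) = ennreal (p x + q x) * ennreal (r' x)"
    if R: "finite_measure (density \<mu> (\<lambda>x. ennreal (r x)))"
      and [measurable]: "r \<in> borel_measurable \<mu>" "r' \<in> borel_measurable \<mu>"
      and d: "density ?M (\<lambda>x. ennreal (r' x)) = density \<mu> (\<lambda>x. ennreal (r x))" for r r' :: "'a \<Rightarrow> real"
  proof (rule finite_density_unique[THEN iffD1])
    interpret R: finite_measure "density \<mu> (\<lambda>x. ennreal (r x))" by fact
    show "integral\<^sup>N \<mu> (\<lambda>x. ennreal (r x)) \<noteq> \<infinity>"
      using R.emeasure_finite[of "space \<mu>"] by (simp add: emeasure_density cong: nn_integral_cong)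
    show "density \<mu> (\<lambda>x. ennreal (r x)) = density \<mu> (\<lambda>x. ennreal (p x + q x) * ennreal (r' x))"
      using d by (simp add: M density_density_eq)
  qed auto
  have 1: "AE x in \<mu>. ennreal (p x) = ennreal (p x + q x) * ennreal (p' x)"
    using P dP by (intro eq) (simp_all add: Pp[symmetric])
  have 2: "AE x in \<mu>. ennreal (q x) = ennreal (p x + q x) * ennreal (q' x)"
    using Q dQ by (intro eq) (simp_all add: Qq[symmetric])
  have "renyi_of_densities ?M p' q' \<alpha> = renyi_of_densities \<mu> p q \<alpha>" for \<alpha>
  proof -
    have "(\<integral>\<^sup>+x. renyi_integrand \<alpha> (p' x) (q' x) \<partial>?M) =
        (\<integral>\<^sup>+x. ennreal (p x + q x) * renyi_integrand \<alpha> (p' x) (q' x) \<partial>\<mu>)"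
      unfolding M by (rule nn_integral_density) auto
    also have "\<dots> = (\<integral>\<^sup>+x. renyi_integrand \<alpha> (p x) (q x) \<partial>\<mu>)"
    proof (rule nn_integral_cong_AE)
      show "AE x in \<mu>. ennreal (p x + q x) * renyi_integrand \<alpha> (p' x) (q' x) =
          renyi_integrand \<alpha> (p x) (q x)"
        using 1 2
      proof eventually_elim
        case (elim x)
        have cancel: "a = b" if "ennreal a = ennreal (p x + q x) * ennreal c"
            "b = (p x + q x) * c" "a \<ge> 0" "c \<ge> 0" for a b c
          using that nonneg[of x] by (metis add_nonneg_nonneg ennreal_inj ennreal_mult mult_nonneg_nonneg)
        have e: "p x = (p x + q x) * p' x" "q x = (p x + q x) * q' x"
          by (rule cancel[OF elim(1) refl nonneg(1) nn'(1)], rule cancel[OF elim(2) refl nonneg(2) nn'(2)])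
        show ?case
        proof (cases "p x + q x = 0")
          case True
          then have "p x = 0" "q x = 0" using nonneg[of x] by linarith+
          then show ?thesis by (simp add: renyi_integrand_def)
        next
          case False
          then have "p x + q x > 0" using nonneg[of x] by (simp add: less_le)
          from renyi_integrand_homogeneous[OF this nn', of \<alpha> x x] show ?thesis
            by (simp only: e[symmetric])
        qed
      qed
    qed
    finally show ?thesis by (simp add: renyi_of_densities_def)
  qed
  then show ?thesis by (auto simp: renyi_simple_def p'_def q'_def)
qed

end

theory Submission
  imports Defs
begin

text \<open>
  Write \<open>I \<alpha> = \<integral> p\<^sup>\<alpha> q\<^sup>1\<^sup>-\<^sup>\<alpha> d\<mu>\<close>, so that \<open>I 1 = 1\<close>. Hoelder's inequality says that \<open>ln I\<close> is convex,
  and hence the slope \<open>ln (I \<alpha>) / (\<alpha> - 1)\<close> of its secant through \<open>1\<close> is nondecreasing. The point \<open>0\<close>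
  plays no special role in this argument, so all three positions of two orders relative to \<open>1\<close> are
  instances of the same inequality. Monotonicity passes to the four orders defined by limits,
  because any two distinct orders are separated by a real number other than \<open>0\<close> and \<open>1\<close>.
\<close>

section \<open>Hoelder's inequality for nonnegative integrals\<close>

text \<open>Young's inequality for the values of \<open>f\<close> and \<open>g\<close> divided by
  \<open>A\<close> and \<open>B\<close>, integrated. Finite integrals make \<open>f\<close> and
  \<open>g\<close> finite almost everywhere, so \<open>h\<close> has to be bounded only at points
  where both are real; this later disposes of the points where the integrand is infinite by
  convention.\<close>

lemma nn_integral_Hoelder_le:
  fixes f g h :: "'a \<Rightarrow> ennreal"
  assumes [measurable]: "f \<in> borel_measurable M" "g \<in> borel_measurable M"
    and \<theta>: "0 < \<theta>" "\<theta> < 1"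
    and AB: "0 \<le> A" "0 \<le> B"
    and f: "(\<integral>\<^sup>+x. f x \<partial>M) = ennreal A" and g: "(\<integral>\<^sup>+x. g x \<partial>M) = ennreal B"
    and h: "\<And>x a b. x \<in> space M \<Longrightarrow> 0 \<le> a \<Longrightarrow> 0 \<le> b \<Longrightarrow> f x = ennreal a \<Longrightarrow> g x = ennreal b \<Longrightarrow>
      h x \<le> ennreal (a powr \<theta> * b powr (1 - \<theta>))"
  shows "(\<integral>\<^sup>+x. h x \<partial>M) \<le> ennreal (A powr \<theta> * B powr (1 - \<theta>))"
proof -
  have fin: "AE x in M. f x \<noteq> \<infinity>" "AE x in M. g x \<noteq> \<infinity>"
    using f g by (intro nn_integral_PInf_AE; simp)+
  have h': "AE x in M. \<exists>a\<ge>0. \<exists>b\<ge>0. f x = ennreal a \<and> g x = ennreal b \<and>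
      h x \<le> ennreal (a powr \<theta> * b powr (1 - \<theta>))"
    using fin AE_space
  proof eventually_elim
    case (elim x)
    obtain a where a: "0 \<le> a" "f x = ennreal a" using elim by (cases "f x") auto
    obtain b where b: "0 \<le> b" "g x = ennreal b" using elim by (cases "g x") auto
    show ?case using h[OF elim(3) a(1) b(1) a(2) b(2)] a b by blast
  qed
  show ?thesis
  \<comment> \<open>With \<open>A\<close> or \<open>B\<close> zero there is nothing to normalise by,
    but then \<open>f\<close> or \<open>g\<close> vanishes almost everywhere, and
    \<open>0 powr \<theta> = 0\<close> forces \<open>h\<close> to vanish too.\<close>
  proof (cases "A = 0 \<or> B = 0")
    case True
    then have "(AE x in M. f x = 0) \<or> (AE x in M. g x = 0)"
      using f g by (auto simp: nn_integral_0_iff_AE)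
    then have "AE x in M. f x = 0 \<or> g x = 0" by (auto elim: AE_mp)
    then have "AE x in M. h x = 0"
      using h' by eventually_elim auto
    then have "(\<integral>\<^sup>+x. h x \<partial>M) = (\<integral>\<^sup>+x. 0 \<partial>M)" by (intro nn_integral_cong_AE) auto
    then show ?thesis by simp
  next
    case False
    then have pos: "A > 0" "B > 0" using AB by auto
    \<comment> \<open>Multiplied by \<open>C\<close>, Young's inequality has
      \<open>a powr \<theta> * b powr (1 - \<theta>)\<close> on the left and a linear combination of
      \<open>f x\<close> and \<open>g x\<close> on the right, whose integral is again
      \<open>C\<close>.\<close>
    define C where "C = A powr \<theta> * B powr (1 - \<theta>)"
    have C: "C \<ge> 0" by (simp add: C_def)
    have coeff: "0 \<le> C * \<theta> / A" "0 \<le> C * (1 - \<theta>) / B"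
      using C \<theta> pos by simp_all
    have "(\<integral>\<^sup>+x. h x \<partial>M) \<le> (\<integral>\<^sup>+x. ennreal (C * \<theta> / A) * f x + ennreal (C * (1 - \<theta>) / B) * g x \<partial>M)"
    proof (rule nn_integral_mono_AE)
      show "AE x in M. h x \<le> ennreal (C * \<theta> / A) * f x + ennreal (C * (1 - \<theta>) / B) * g x"
        using h'
      proof eventually_elim
        case (elim x)
        then obtain a b where ab: "0 \<le> a" "0 \<le> b" "f x = ennreal a" "g x = ennreal b"
          and hx: "h x \<le> ennreal (a powr \<theta> * b powr (1 - \<theta>))" by blast
        have "(a / A) powr \<theta> * (b / B) powr (1 - \<theta>) \<le> \<theta> * (a / A) + (1 - \<theta>) * (b / B)"
        proof (cases "a = 0 \<or> b = 0")
          case True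
          then show ?thesis using \<theta> ab pos by auto
        next
          case False
          then have "a / A > 0" "b / B > 0" using ab pos by (simp_all add: less_le)
          then show ?thesis using \<theta> by (intro Youngs_inequality_0) auto
        qed
        then have "C * ((a / A) powr \<theta> * (b / B) powr (1 - \<theta>)) \<le> C * (\<theta> * (a / A) + (1 - \<theta>) * (b / B))"
          using C by (rule mult_left_mono)
        moreover have "C * ((a / A) powr \<theta> * (b / B) powr (1 - \<theta>)) = a powr \<theta> * b powr (1 - \<theta>)"
          using pos ab by (simp add: C_def powr_divide)
        ultimately have "a powr \<theta> * b powr (1 - \<theta>) \<le> C * \<theta> / A * a + C * (1 - \<theta>) / B * b"
          by (simp add: algebra_simps)
        then have "h x \<le> ennreal (C * \<theta> / A * a + C * (1 - \<theta>) / B * b)"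
          using hx by (meson ennreal_leI order_trans)
        then show ?case
          using ab coeff by (simp only: ennreal_mult ennreal_plus mult_nonneg_nonneg)
      qed
    qed
    also have "\<dots> = ennreal (C * \<theta> / A) * ennreal A + ennreal (C * (1 - \<theta>) / B) * ennreal B"
      by (simp add: nn_integral_add nn_integral_cmult f g)
    also have "\<dots> = ennreal (C * \<theta> / A * A + C * (1 - \<theta>) / B * B)"
      using AB coeff by (simp only: ennreal_mult ennreal_plus mult_nonneg_nonneg)
    also have "C * \<theta> / A * A + C * (1 - \<theta>) / B * B = C * \<theta> + C * (1 - \<theta>)"
      using pos by simp
    also have "\<dots> = C" by (simp add: algebra_simps)
    finally show ?thesis by (simp add: C_def)
  qed
qed

section \<open>Pointwise behaviour of the integrand in the order\<close>

text \<open>At positive densities the three branches agree. The form chosen shows an exponential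
  function of the order, and it also covers order 1, where the value is \<open>x\<close>.\<close>

lemma renyi_integrand_pos:
  assumes "x > 0" "y > 0"
  shows "renyi_integrand \<alpha> x y = ennreal (x * (y / x) powr (1 - \<alpha>))"
proof -
  have "x * (y / x) powr (1 - \<alpha>) = x powr \<alpha> * y powr (1 - \<alpha>)"
    using assms by (simp add: powr_divide powr_diff)
  moreover have "x powr \<alpha> / y powr (\<alpha> - 1) = x powr \<alpha> * y powr (1 - \<alpha>)"
    using assms by (simp add: powr_diff)
  moreover have "y powr (1 - \<alpha>) / x powr (- \<alpha>) = x powr \<alpha> * y powr (1 - \<alpha>)"
    using assms by (simp add: powr_minus divide_inverse)
  ultimately show ?thesis
    using assms by (simp add: renyi_integrand_def divide_ennreal)
qed

lemma renyi_integrand_zero_left: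
  assumes "y > 0"
  shows "renyi_integrand \<alpha> 0 y = (if \<alpha> < 0 then \<infinity> else 0)"
  using assms by (simp add: renyi_integrand_def ennreal_divide_zero)

lemma renyi_integrand_zero_right:
  assumes "x > 0"
  shows "renyi_integrand \<alpha> x 0 = (if \<alpha> > 1 then \<infinity> else 0)"
  using assms by (simp add: renyi_integrand_def ennreal_divide_zero)

lemma renyi_integrand_zero_zero: "renyi_integrand \<alpha> 0 0 = 0"
  by (simp add: renyi_integrand_def)

lemmas renyi_integrand_simps =
  renyi_integrand_zero_left renyi_integrand_zero_right renyi_integrand_zero_zero

text \<open>For fixed positive \<open>x\<close> and \<open>y\<close> the logarithm of the integrand
  is affine in the order, hence the equality.\<close>

lemma renyi_integrand_log_convex:
  assumes "x > 0" "y > 0" and \<gamma>: "\<gamma> = \<theta> * \<alpha> + (1 - \<theta>) * \<beta>"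
    and ab: "0 \<le> a" "0 \<le> b"
    and "renyi_integrand \<alpha> x y = ennreal a" "renyi_integrand \<beta> x y = ennreal b"
  shows "renyi_integrand \<gamma> x y = ennreal (a powr \<theta> * b powr (1 - \<theta>))"
proof -
  have "a = x * (y / x) powr (1 - \<alpha>)" "b = x * (y / x) powr (1 - \<beta>)"
    using assms by (simp_all add: renyi_integrand_pos)
  then have "a powr \<theta> * b powr (1 - \<theta>) =
      (x powr \<theta> * x powr (1 - \<theta>)) * ((y / x) powr ((1 - \<alpha>) * \<theta>) * (y / x) powr ((1 - \<beta>) * (1 - \<theta>)))"
    using assms by (simp add: powr_mult powr_powr mult_ac)
  also have "\<dots> = x * (y / x) powr (1 - \<gamma>)"
    using assms(1,2) by (simp add: powr_add[symmetric] \<gamma> algebra_simps)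
  finally show ?thesis using assms(1,2) by (simp add: renyi_integrand_pos)
qed

section \<open>Monotonicity at real orders other than 0 and 1\<close>

text \<open>Of the three orders \<alpha>, \<beta> and 1, the middle one is a convex combination of
  the outer two, and Hoelder's inequality bounds its integral by theirs.\<close>

lemma renyi_of_densities_mono:
  fixes p q :: "'a \<Rightarrow> real"
  assumes [measurable]: "p \<in> borel_measurable \<mu>" "q \<in> borel_measurable \<mu>"
    and nonneg: "\<And>x. p x \<ge> 0" "\<And>x. q x \<ge> 0"
    and p1: "(\<integral>\<^sup>+x. ennreal (p x) \<partial>\<mu>) = 1"
    and \<alpha>\<beta>: "\<alpha> < \<beta>" "\<alpha> \<notin> {0, 1}" "\<beta> \<notin> {0, 1}"
  shows "renyi_of_densities \<mu> p q \<alpha> \<le> renyi_of_densities \<mu> p q \<beta>"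
proof -
  define I where "I \<gamma> = (\<integral>\<^sup>+x. renyi_integrand \<gamma> (p x) (q x) \<partial>\<mu>)" for \<gamma>
  have p1': "(\<integral>\<^sup>+x. ennreal (p x) \<partial>\<mu>) = ennreal 1" using p1 by simp
  have D: "renyi_of_densities \<mu> p q \<gamma> = ereal (1 / (\<gamma> - 1)) * ln_ennreal (I \<gamma>)" for \<gamma>
    by (simp add: renyi_of_densities_def I_def)
  have Dfin: "renyi_of_densities \<mu> p q \<gamma> = ereal (ln C / (\<gamma> - 1))" if "I \<gamma> = ennreal C" "C > 0" for \<gamma> C
    using that by (simp add: D ln_ennreal_def)
  have Dzero: "renyi_of_densities \<mu> p q \<gamma> = (if \<gamma> < 1 then \<infinity> else -\<infinity>)" if "I \<gamma> = 0" "\<gamma> \<noteq> 1" for \<gamma>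
    using that by (simp add: D ln_ennreal_def)
  have Dtop: "renyi_of_densities \<mu> p q \<gamma> = (if \<gamma> < 1 then -\<infinity> else \<infinity>)" if "I \<gamma> = \<infinity>" "\<gamma> \<noteq> 1" for \<gamma>
    using that by (simp add: D ln_ennreal_def)
  \<comment> \<open>At order 1, \<open>p\<close> itself is used in place of the integrand: since
    \<open>0 powr 0 = 0\<close>, the integrand is 0 where \<open>q\<close> vanishes and may lose
    mass of \<open>p\<close>.\<close>
  have x1: "renyi_integrand 1 u v = ennreal u" if "u > 0" "v > 0" for u v
    using that by (simp add: renyi_integrand_pos)
  \<comment> \<open>Where a density vanishes, the bound required by Hoelder's inequality holds
    because its left side is 0 or one of the two outer functions is infinite.\<close>
  have cases: thesis if "\<And>u v. p x = u \<Longrightarrow> q x = v \<Longrightarrow> u > 0 \<Longrightarrow> v > 0 \<Longrightarrow> thesis"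
    "\<And>v. p x = 0 \<Longrightarrow> q x = v \<Longrightarrow> v > 0 \<Longrightarrow> thesis" "\<And>u. p x = u \<Longrightarrow> q x = 0 \<Longrightarrow> u > 0 \<Longrightarrow> thesis"
    "p x = 0 \<Longrightarrow> q x = 0 \<Longrightarrow> thesis" for x thesis
    using that nonneg[of x] by (metis less_eq_real_def)
  consider "\<beta> < 1" | "1 < \<alpha>" | "\<alpha> < 1" "1 < \<beta>" using \<alpha>\<beta> by fastforce
  then show ?thesis
  proof cases
    case 1
    show ?thesis
    proof (cases "I \<alpha>")
      case (real A)
      \<comment> \<open>The weight of \<alpha> when \<beta> is written as a convex combination of
        \<alpha> and 1.\<close>
      define \<theta> where "\<theta> = (1 - \<beta>) / (1 - \<alpha>)"
      have \<theta>: "0 < \<theta>" "\<theta> < 1" using 1 \<alpha>\<beta> by (simp_all add: \<theta>_def)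
      have "\<theta> * (1 - \<alpha>) = 1 - \<beta>" using 1 \<alpha>\<beta> by (simp add: \<theta>_def)
      then have \<theta>': "\<beta> = \<theta> * \<alpha> + (1 - \<theta>) * 1" by (simp add: algebra_simps)
      have "I \<beta> \<le> ennreal (A powr \<theta> * 1 powr (1 - \<theta>))"
        unfolding I_def
      proof (rule nn_integral_Hoelder_le[OF _ _ \<theta> real(1) zero_le_one real(2)[unfolded I_def] p1'])
        fix x a b assume *: "0 \<le> a" "0 \<le> b" "renyi_integrand \<alpha> (p x) (q x) = ennreal a"
          "ennreal (p x) = ennreal b"
        show "renyi_integrand \<beta> (p x) (q x) \<le> ennreal (a powr \<theta> * b powr (1 - \<theta>))"
          using 1 \<alpha>\<beta> * renyi_integrand_log_convex[OF _ _ \<theta>' *(1,2,3)]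
          by (cases rule: cases[of x]) (auto simp: renyi_integrand_simps x1 split: if_splits)
      qed simp_all
      then have le: "I \<beta> \<le> ennreal (A powr \<theta>)" by simp
      then obtain B where B: "I \<beta> = ennreal B" "B \<ge> 0"
        by (cases "I \<beta>") (auto simp: top_unique)
      then have BA: "B \<le> A powr \<theta>" using le by simp
      show ?thesis
      proof (cases "B = 0")
        case True
        then show ?thesis using Dzero[of \<beta>] B 1 by simp
      next
        case False
        then have pos: "B > 0" "A > 0" using B BA real by (auto simp: less_le)
        then have "ln B \<le> ln (A powr \<theta>)" using BA by (subst ln_le_cancel_iff) auto
        then have "ln B \<le> (1 - \<beta>) / (1 - \<alpha>) * ln A" using pos by (simp add: ln_powr \<theta>_def)
        \<comment> \<open>Division by the negative number \<open>\<beta> - 1\<close> reverses the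
          inequality.\<close>
        then have "ln A / (\<alpha> - 1) \<le> ln B / (\<beta> - 1)"
          using 1 \<alpha>\<beta> by (simp add: field_simps)
        then show ?thesis using Dfin[OF real(2) pos(2)] Dfin[OF B(1) pos(1)] by simp
      qed
    next
      case top
      then show ?thesis using Dtop[of \<alpha>] 1 \<alpha>\<beta> by simp
    qed
  next
    case 2
    show ?thesis
    proof (cases "I \<beta>")
      case (real B)
      \<comment> \<open>Now \<alpha> is the middle order, and \<theta> is the weight of \<beta>
        against 1.\<close>
      define \<theta> where "\<theta> = (\<alpha> - 1) / (\<beta> - 1)"
      have \<theta>: "0 < \<theta>" "\<theta> < 1" using 2 \<alpha>\<beta> by (simp_all add: \<theta>_def)
      have "\<theta> * (\<beta> - 1) = \<alpha> - 1" using 2 \<alpha>\<beta> by (simp add: \<theta>_def)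
      then have \<theta>': "\<alpha> = \<theta> * \<beta> + (1 - \<theta>) * 1" by (simp add: algebra_simps)
      have "I \<alpha> \<le> ennreal (B powr \<theta> * 1 powr (1 - \<theta>))"
        unfolding I_def
      proof (rule nn_integral_Hoelder_le[OF _ _ \<theta> real(1) zero_le_one real(2)[unfolded I_def] p1'])
        fix x a b assume *: "0 \<le> a" "0 \<le> b" "renyi_integrand \<beta> (p x) (q x) = ennreal a"
          "ennreal (p x) = ennreal b"
        show "renyi_integrand \<alpha> (p x) (q x) \<le> ennreal (a powr \<theta> * b powr (1 - \<theta>))"
          using 2 \<alpha>\<beta> * renyi_integrand_log_convex[OF _ _ \<theta>' *(1,2,3)]
          by (cases rule: cases[of x]) (auto simp: renyi_integrand_simps x1 split: if_splits)
      qed simp_all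
      then have le: "I \<alpha> \<le> ennreal (B powr \<theta>)" by simp
      then obtain A where A: "I \<alpha> = ennreal A" "A \<ge> 0"
        by (cases "I \<alpha>") (auto simp: top_unique)
      then have AB: "A \<le> B powr \<theta>" using le by simp
      show ?thesis
      proof (cases "A = 0")
        case True
        then show ?thesis using Dzero[of \<alpha>] A 2 by simp
      next
        case False
        then have pos: "A > 0" "B > 0" using A AB real by (auto simp: less_le)
        then have "ln A \<le> ln (B powr \<theta>)" using AB by (subst ln_le_cancel_iff) auto
        then have "ln A \<le> (\<alpha> - 1) / (\<beta> - 1) * ln B" using pos by (simp add: ln_powr \<theta>_def)
        then have "ln A / (\<alpha> - 1) \<le> ln B / (\<beta> - 1)"
          using 2 \<alpha>\<beta> by (simp add: field_simps)
        then show ?thesis using Dfin[OF A(1) pos(1)] Dfin[OF real(2) pos(2)] by simp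
      qed
    next
      case top
      then show ?thesis using Dtop[of \<beta>] 2 \<alpha>\<beta> by simp
    qed
  next
    case 3
    show ?thesis
    proof (cases "I \<alpha> = \<infinity> \<or> I \<beta> = \<infinity>")
      case True
      then show ?thesis using Dtop[of \<alpha>] Dtop[of \<beta>] 3 by auto
    next
      case False
      then obtain A B where A: "0 \<le> A" "I \<alpha> = ennreal A" and B: "0 \<le> B" "I \<beta> = ennreal B"
        by (cases "I \<alpha>"; cases "I \<beta>") auto
      \<comment> \<open>Here 1 is the middle order, so Hoelder's inequality gives a lower bound for
        a product of powers of \<open>A\<close> and \<open>B\<close>.\<close>
      define \<theta> where "\<theta> = (\<beta> - 1) / (\<beta> - \<alpha>)"
      have \<theta>: "0 < \<theta>" "\<theta> < 1" using 3 by (simp_all add: \<theta>_def)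
      have eq: "\<theta> * (\<beta> - \<alpha>) = \<beta> - 1" using 3 by (simp add: \<theta>_def)
      then have \<theta>': "1 = \<theta> * \<alpha> + (1 - \<theta>) * \<beta>" by (simp add: algebra_simps)
      have "(\<integral>\<^sup>+x. ennreal (p x) \<partial>\<mu>) \<le> ennreal (A powr \<theta> * B powr (1 - \<theta>))"
      proof (rule nn_integral_Hoelder_le[OF _ _ \<theta> A(1) B(1) A(2)[unfolded I_def] B(2)[unfolded I_def]])
        fix x a b assume *: "0 \<le> a" "0 \<le> b" "renyi_integrand \<alpha> (p x) (q x) = ennreal a"
          "renyi_integrand \<beta> (p x) (q x) = ennreal b"
        show "ennreal (p x) \<le> ennreal (a powr \<theta> * b powr (1 - \<theta>))"
          using 3 * renyi_integrand_log_convex[OF _ _ \<theta>' *]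
          by (cases rule: cases[of x]) (auto simp: renyi_integrand_simps x1 split: if_splits)
      qed simp_all
      then have le: "1 \<le> A powr \<theta> * B powr (1 - \<theta>)" using p1 by simp
      \<comment> \<open>If \<open>A\<close> or \<open>B\<close> were 0, the product would be 0 and
        not at least 1.\<close>
      then have pos: "A > 0" "B > 0" using A B by (auto simp: less_le)
      have "0 \<le> ln (A powr \<theta> * B powr (1 - \<theta>))" using le by simp
      also have "\<dots> = \<theta> * ln A + (1 - \<theta>) * ln B" using pos by (simp add: ln_mult ln_powr)
      finally have "0 \<le> (\<beta> - \<alpha>) * (\<theta> * ln A + (1 - \<theta>) * ln B)"
        using 3 by simp
      also have "\<dots> = (\<theta> * (\<beta> - \<alpha>)) * ln A + ((\<beta> - \<alpha>) - \<theta> * (\<beta> - \<alpha>)) * ln B"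
        by (simp add: algebra_simps)
      also have "\<dots> = (\<beta> - 1) * ln A + (1 - \<alpha>) * ln B"
        by (simp add: eq)
      finally have "0 \<le> (\<beta> - 1) * ln A + (1 - \<alpha>) * ln B" .
      then have "ln A / (\<alpha> - 1) \<le> ln B / (\<beta> - 1)"
        using 3 by (simp add: field_simps)
      then show ?thesis using Dfin[OF A(2) pos(1)] Dfin[OF B(2) pos(2)] by simp
    qed
  qed
qed

text \<open>\<open>P\<close> is absolutely continuous with respect to the sum measure, so its real
  density integrates to 1 and the inequality for densities applies. Orders 0 and 1 are left out
  because \<open>renyi_simple\<close> is not the divergence there; at 1 the convention
  \<open>1 / 0 = 0\<close> makes it 0.\<close>

lemma renyi_simple_mono:
  assumes "prob_space P" "finite_measure Q" "sets P = sets Q"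
  shows "mono_on (- {0, 1}) (renyi_simple P Q)"
proof (rule mono_onI)
  fix \<alpha> \<beta> :: real assume \<alpha>\<beta>: "\<alpha> \<in> - {0, 1}" "\<beta> \<in> - {0, 1}" "\<alpha> \<le> \<beta>"
  interpret P: prob_space P by fact
  interpret Q: finite_measure Q by fact
  let ?M = "sum_measure P Q"
  have fM: "finite_measure ?M"
  proof
    have "emeasure ?M (space P) = emeasure P (space P) + emeasure Q (space P)"
      by (rule emeasure_sum_measure[OF assms(3)]) simp
    then show "emeasure ?M (space ?M) \<noteq> \<infinity>" by simp
  qed
  have ac: "absolutely_continuous ?M P"
    by (auto simp: absolutely_continuous_def null_sets_def emeasure_sum_measure[OF assms(3)])
  have [measurable]: "real_density ?M R \<in> borel_measurable ?M" for R
    by (simp add: real_density_def[abs_def])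
  have "emeasure (density ?M (\<lambda>x. ennreal (real_density ?M P x))) (space ?M) =
      (\<integral>\<^sup>+x. ennreal (real_density ?M P x) \<partial>?M)"
    by (subst emeasure_density) (auto intro!: nn_integral_cong)
  then have "(\<integral>\<^sup>+x. ennreal (real_density ?M P x) \<partial>?M) = 1"
    using density_real_density[OF fM P.finite_measure_axioms ac] P.emeasure_space_1 by simp
  then show "renyi_simple P Q \<alpha> \<le> renyi_simple P Q \<beta>"
    using \<alpha>\<beta> renyi_of_densities_mono[of "real_density ?M P" ?M "real_density ?M Q" \<alpha> \<beta>]
    by (cases "\<alpha> = \<beta>") (auto simp: renyi_simple_def real_density_def)
qed

section \<open>Passage to the orders defined by limits\<close>

text \<open>Any bound above the infimum exceeds some \<open>f s\<close>, and eventually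
  \<open>x\<close> is in \<open>S\<close> and below \<open>s\<close>. Stating this for a filter
  treats \<open>at_bot\<close> and \<open>at_right 0\<close> alike.\<close>

lemma tendsto_Inf_mono_on:
  fixes f :: "'a::order \<Rightarrow> 'b::{complete_linorder, linorder_topology}"
  assumes "mono_on S f" "eventually (\<lambda>x. x \<in> S) F"
    and "\<And>s. s \<in> S \<Longrightarrow> eventually (\<lambda>x. x \<le> s) F"
  shows "(f \<longlongrightarrow> (INF s\<in>S. f s)) F"
proof (rule order_tendstoI)
  fix a assume "a < (INF s\<in>S. f s)"
  then show "eventually (\<lambda>x. a < f x) F"
    using assms(2) by (auto elim!: eventually_mono intro: less_le_trans INF_lower)
next
  fix a assume "(INF s\<in>S. f s) < a"
  then obtain s where s: "s \<in> S" "f s < a" by (auto simp: INF_less_iff)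
  show "eventually (\<lambda>x. f x < a) F"
    using assms(2) assms(3)[OF s(1)]
    by eventually_elim (use s assms(1) in \<open>auto intro: le_less_trans dest: mono_onD\<close>)
qed

lemma tendsto_Sup_mono_on:
  fixes f :: "'a::order \<Rightarrow> 'b::{complete_linorder, linorder_topology}"
  assumes "mono_on S f" "eventually (\<lambda>x. x \<in> S) F"
    and "\<And>s. s \<in> S \<Longrightarrow> eventually (\<lambda>x. s \<le> x) F"
  shows "(f \<longlongrightarrow> (SUP s\<in>S. f s)) F"
proof (rule order_tendstoI)
  fix a assume "(SUP s\<in>S. f s) < a"
  then show "eventually (\<lambda>x. f x < a) F"
    using assms(2) by (auto elim!: eventually_mono intro: le_less_trans SUP_upper)
next
  fix a assume "a < (SUP s\<in>S. f s)"
  then obtain s where s: "s \<in> S" "a < f s" by (auto simp: less_SUP_iff)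
  show "eventually (\<lambda>x. a < f x) F"
    using assms(2) assms(3)[OF s(1)]
    by eventually_elim (use s assms(1) in \<open>auto intro: less_le_trans dest: mono_onD\<close>)
qed

text \<open>This replaces the five branches of the definition by one description: a limit along a
  filter that avoids 0 and 1 and ends up on the correct side of every real number different from
  \<alpha>.\<close>

lemma renyi_divergence_is_limit:
  assumes mono: "mono_on (- {0, 1}) (renyi_simple P Q)"
  obtains F where "F \<noteq> bot" "(renyi_simple P Q \<longlongrightarrow> renyi_divergence \<alpha> P Q) F"
    and "eventually (\<lambda>x. x \<in> - {0, 1}) F"
    and "\<And>r. \<alpha> < ereal r \<Longrightarrow> eventually (\<lambda>x. x \<le> r) F"
    and "\<And>r. ereal r < \<alpha> \<Longrightarrow> eventually (\<lambda>x. r \<le> x) F"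
proof -
  let ?f = "renyi_simple P Q"
  have sub: "mono_on S ?f" if "S \<subseteq> - {0, 1}" for S
    using mono that by (rule mono_on_subset)
  \<comment> \<open>\<open>Lim\<close> is a definite description, so it says something only once
    convergence to some value is known.\<close>
  have lim: "(?f \<longlongrightarrow> Lim F ?f) F" if "F \<noteq> bot" "(?f \<longlongrightarrow> l) F" for F l
    using that tendsto_Lim by blast
  consider "\<alpha> = -\<infinity>" | "\<alpha> = \<infinity>" | "\<alpha> = 0" | "\<alpha> = 1" | a where "\<alpha> = ereal a" "a \<noteq> 0" "a \<noteq> 1"
    by (cases \<alpha>) (auto simp: zero_ereal_def one_ereal_def)
  then show thesis
  proof cases
    case 1
    have ev: "eventually (\<lambda>x. x < 0) (at_bot :: real filter)" by (rule eventually_gt_at_bot)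
    \<comment> \<open>In each limit case the extremum is taken over an interval that adjoins the
      limiting order and misses 0 and 1.\<close>
    have "(?f \<longlongrightarrow> (INF s\<in>{..<0}. ?f s)) at_bot"
      by (rule tendsto_Inf_mono_on[OF sub]) (auto intro: ev eventually_le_at_bot)
    then show thesis
      using 1 by (intro that[of at_bot])
        (auto simp: renyi_divergence_def intro!: lim intro: eventually_le_at_bot eventually_mono[OF ev])
  next
    case 2
    have ev: "eventually (\<lambda>x. 1 < x) (at_top :: real filter)" by (rule eventually_gt_at_top)
    have "(?f \<longlongrightarrow> (SUP s\<in>{1<..}. ?f s)) at_top"
      by (rule tendsto_Sup_mono_on[OF sub]) (auto intro: ev eventually_ge_at_top)
    then show thesis
      using 2 by (intro that[of at_top])
        (auto simp: renyi_divergence_def intro!: lim intro: eventually_ge_at_top eventually_mono[OF ev])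
  next
    case 3
    have ev: "eventually (\<lambda>x. x \<in> {0<..<r}) (at_right 0)" if "0 < r" for r :: real
      using that by (rule eventually_at_right_real)
    have "(?f \<longlongrightarrow> (INF s\<in>{0<..<1}. ?f s)) (at_right 0)"
      by (rule tendsto_Inf_mono_on[OF sub]) (auto intro: ev[of 1, simplified] eventually_mono[OF ev])
    then show thesis
      using 3 by (intro that[of "at_right 0"])
        (auto simp: renyi_divergence_def intro!: lim intro: eventually_mono[OF ev[of 1]] eventually_mono[OF ev])
  next
    case 4
    have ev: "eventually (\<lambda>x. x \<in> {r<..<1}) (at_left 1)" if "r < 1" for r :: real
      using that by (rule eventually_at_left_real)
    have "(?f \<longlongrightarrow> (SUP s\<in>{0<..<1}. ?f s)) (at_left 1)"
      by (rule tendsto_Sup_mono_on[OF sub]) (auto intro: ev[of 0, simplified] eventually_mono[OF ev])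
    then show thesis
      using 4 by (intro that[of "at_left 1"])
        (auto simp: renyi_divergence_def intro!: lim intro: eventually_mono[OF ev[of 0]] eventually_mono[OF ev])
  next
    case 5
    \<comment> \<open>An ordinary order is the limit along the filter of the single point
      \<open>a\<close>.\<close>
    have "(?f \<longlongrightarrow> ?f a) (principal {a})"
      by (auto simp: tendsto_def eventually_principal)
    then show thesis
      using 5 by (intro that[of "principal {a}"])
        (auto simp: renyi_divergence_def eventually_principal principal_eq_bot_iff)
  qed
qed

section \<open>Monotonicity over all extended real orders\<close>

theorem theorem39:
  fixes P Q :: "'a measure"
  assumes "prob_space P" and "prob_space Q" and "sets P = sets Q"
  shows "mono (\<lambda>\<alpha> :: ereal. renyi_divergence \<alpha> P Q)"
proof (rule monoI)
  fix \<alpha> \<beta> :: ereal assume "\<alpha> \<le> \<beta>"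
  have mono: "mono_on (- {0, 1}) (renyi_simple P Q)"
    using assms by (intro renyi_simple_mono prob_space.finite_measure)
  show "renyi_divergence \<alpha> P Q \<le> renyi_divergence \<beta> P Q"
  proof (cases "\<alpha> = \<beta>")
    case False
    then have "\<alpha> < \<beta>" using \<open>\<alpha> \<le> \<beta>\<close> by simp
    then obtain s t where st: "\<alpha> < ereal s" "ereal s < ereal t" "ereal t < \<beta>"
      by (meson ereal_dense2)
    \<comment> \<open>An open interval of reals is infinite, so it keeps a point \<open>r\<close>
      after 0 and 1 are removed. Both divergences are then compared with the value at
      \<open>r\<close>.\<close>
    have "infinite {s<..<t}" using st by (simp add: infinite_Ioo)
    then have "infinite ({s<..<t} - {0, 1})" by (rule Diff_infinite_finite[rotated]) simp
    then obtain r where "r \<in> {s<..<t} - {0, 1}" by (metis finite.emptyI ex_in_conv)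
    then have r: "r \<in> - {0, 1}" "\<alpha> < ereal r" "ereal r < \<beta>"
      using st by (auto intro: less_trans[of _ "ereal s"] less_trans[of _ "ereal t"])
    obtain F where F: "F \<noteq> bot" "(renyi_simple P Q \<longlongrightarrow> renyi_divergence \<alpha> P Q) F"
      "eventually (\<lambda>x. x \<in> - {0, 1}) F" "eventually (\<lambda>x. x \<le> r) F"
      using renyi_divergence_is_limit[OF mono, of \<alpha>] r by metis
    have "eventually (\<lambda>x. renyi_simple P Q x \<le> renyi_simple P Q r) F"
      using F(3,4) by eventually_elim (rule mono_onD[OF mono _ r(1)])
    then have le: "renyi_divergence \<alpha> P Q \<le> renyi_simple P Q r"
      by (rule tendsto_upperbound[OF F(2) _ F(1)])
    obtain G where G: "G \<noteq> bot" "(renyi_simple P Q \<longlongrightarrow> renyi_divergence \<beta> P Q) G"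
      "eventually (\<lambda>x. x \<in> - {0, 1}) G" "eventually (\<lambda>x. r \<le> x) G"
      using renyi_divergence_is_limit[OF mono, of \<beta>] r by metis
    have "eventually (\<lambda>x. renyi_simple P Q r \<le> renyi_simple P Q x) G"
      using G(3,4) by eventually_elim (rule mono_onD[OF mono r(1)])
    then have ge: "renyi_simple P Q r \<le> renyi_divergence \<beta> P Q"
      by (rule tendsto_lowerbound[OF G(2) _ G(1)])
    from le ge show ?thesis by (rule order_trans)
  qed simp
qed

end
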